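(* Let $h\ge 2$ be an even integer and $r\ge 1$ an integer. Let $Y$ be the graph obtained from $X_{h,r}$ by the $r$-direction construction: add a set $V_{r+1}=\{x_1,y_1,\dots,x_{h/2},y_{h/2}\}$ of $h$ new vertices, add the $\frac h2$ disjoint edges $(x_j,y_j)$ for $1\le j\le \frac h2$ (so that $V_{r+1}$ induces $\frac h2K_2$), and join every vertex of $V_{r+1}$ to every vertex of $X_{h,r}$. Then $Y\cong X_{h,r+1}$.
   Context: All graphs are finite, simple and undirected. For an even integer $h\ge 2$ and an integer $r\ge 1$, the graph $X_{h,r}$ is the join $$X_{h,r}=\overline{K}_{h-1}\vee\left(\bigvee_{i=1}^{r}\left(\tfrac h2\right)K_2\right),$$ where $\overline{K}_{h-1}$ is the edgeless graph on $h-1$ vertices, $\left(\frac h2\right)K_2$ is the disjoint union of $\frac h2$ copies of $K_2$, and the join $\vee$ of pairwise vertex-disjoint graphs is obtained from their disjoint union by adding all edges between vertices of different constituents. *)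

theory Defs
  imports "Graph_Theory.Graph_Theory"
begin

text \<open>
  A finite simple undirected graph is a \<^locale>\<open>pair_graph\<close>: a finite, loop-free
  digraph without parallel arcs in which every undirected edge is represented by its two
  opposite arcs. Isomorphism is \<^const>\<open>digraph_iso\<close>, applied through the embedding
  \<^const>\<open>with_proj\<close> of pair digraphs into digraphs.
\<close>

definition edgeless_graph :: "nat \<Rightarrow> nat pair_pre_digraph" where
  "edgeless_graph n = \<lparr> pverts = {0..<n}, parcs = {} \<rparr>"

definition complete_graph :: "nat \<Rightarrow> nat pair_pre_digraph" where
  "complete_graph n =
     \<lparr> pverts = {0..<n}, parcs = {(u, v). u \<in> {0..<n} \<and> v \<in> {0..<n} \<and> u \<noteq> v} \<rparr>"

text \<open>
  Disjoint unions and joins make their constituents vertex-disjoint by tagging: a vertex of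
  a constituent is paired with the index of that constituent (families), or injected into
  a sum type (two graphs).
\<close>

definition disjoint_union ::
  "'i set \<Rightarrow> ('i \<Rightarrow> 'a pair_pre_digraph) \<Rightarrow> ('i \<times> 'a) pair_pre_digraph" where
  "disjoint_union I G =
     \<lparr> pverts = {(i, v). i \<in> I \<and> v \<in> pverts (G i)},
       parcs = {((i, u), (j, v)). i \<in> I \<and> i = j \<and> (u, v) \<in> parcs (G i)} \<rparr>"

definition copies :: "nat \<Rightarrow> 'a pair_pre_digraph \<Rightarrow> (nat \<times> 'a) pair_pre_digraph" where
  "copies m G = disjoint_union {1..m} (\<lambda>_. G)"

definition family_join ::
  "'i set \<Rightarrow> ('i \<Rightarrow> 'a pair_pre_digraph) \<Rightarrow> ('i \<times> 'a) pair_pre_digraph" where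
  "family_join I G =
     \<lparr> pverts = pverts (disjoint_union I G),
       parcs = parcs (disjoint_union I G) \<union>
         {((i, u), (j, v)). i \<in> I \<and> j \<in> I \<and> i \<noteq> j \<and> u \<in> pverts (G i) \<and> v \<in> pverts (G j)} \<rparr>"

definition graph_join ::
  "'a pair_pre_digraph \<Rightarrow> 'b pair_pre_digraph \<Rightarrow> ('a + 'b) pair_pre_digraph" where
  "graph_join G H =
     \<lparr> pverts = Inl ` pverts G \<union> Inr ` pverts H,
       parcs = {(Inl u, Inl v) |u v. (u, v) \<in> parcs G} \<union> {(Inr u, Inr v) |u v. (u, v) \<in> parcs H} \<union>
         {(Inl u, Inr v) |u v. u \<in> pverts G \<and> v \<in> pverts H} \<union>
         {(Inr v, Inl u) |u v. u \<in> pverts G \<and> v \<in> pverts H} \<rparr>"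

definition X_graph :: "nat \<Rightarrow> nat \<Rightarrow> (nat + nat \<times> nat \<times> nat) pair_pre_digraph" where
  "X_graph h r =
     graph_join (edgeless_graph (h - 1))
       (family_join {1..r} (\<lambda>_. copies (h div 2) (complete_graph 2)))"

text \<open>
  The \<open>r\<close>-direction construction applied to \<open>G\<close>, with new vertices
  \<open>x 1, y 1, \<dots>, x m, y m\<close>. It is meaningful only if these are \<open>2 * m\<close> distinct vertices
  outside \<open>G\<close>, which is what \<open>new_vertices\<close> expresses.
\<close>

definition new_vertices ::
  "'a pair_pre_digraph \<Rightarrow> nat \<Rightarrow> (nat \<Rightarrow> 'a) \<Rightarrow> (nat \<Rightarrow> 'a) \<Rightarrow> bool" where
  "new_vertices G m x y \<longleftrightarrow>
     inj_on x {1..m} \<and> inj_on y {1..m} \<and> x ` {1..m} \<inter> y ` {1..m} = {} \<and>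
     (x ` {1..m} \<union> y ` {1..m}) \<inter> pverts G = {}"

definition r_direction ::
  "'a pair_pre_digraph \<Rightarrow> nat \<Rightarrow> (nat \<Rightarrow> 'a) \<Rightarrow> (nat \<Rightarrow> 'a) \<Rightarrow> 'a pair_pre_digraph" where
  "r_direction G m x y =
     (let V = x ` {1..m} \<union> y ` {1..m} in
      \<lparr> pverts = pverts G \<union> V,
        parcs = parcs G \<union>
          (\<Union>j \<in> {1..m}. {(x j, y j), (y j, x j)}) \<union>
          (V \<times> pverts G) \<union> (pverts G \<times> V) \<rparr>)"

lemma pair_graph_iff:
  "pair_graph G \<longleftrightarrow> finite (pverts G) \<and> parcs G \<subseteq> pverts G \<times> pverts G \<and>
     sym (parcs G) \<and> (\<forall>v. (v, v) \<notin> parcs G)" (is "_ \<longleftrightarrow> ?R")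
proof
  assume "pair_graph G"
  then interpret pair_graph G .
  show ?R
    using pair_finite_verts pair_sym_arcs arcs_symmetric no_loops'
    by (auto dest: in_arcsD1 in_arcsD2 intro: symI)
next
  assume R: ?R
  then have "finite (parcs G)"
    by (meson finite_SigmaI finite_subset)
  with R show "pair_graph G"
    by unfold_locales (auto simp: symmetric_def)
qed

lemma pair_graph_edgeless: "pair_graph (edgeless_graph n)"
  by (auto simp: pair_graph_iff edgeless_graph_def sym_def)

lemma pair_graph_complete: "pair_graph (complete_graph n)"
  by (auto simp: pair_graph_iff complete_graph_def sym_def)

lemma complete_digraph_complete_graph: "complete_digraph n (with_proj (complete_graph n))"
  using pair_graph.pair_graphD_graph[OF pair_graph_complete]
  by (auto simp: complete_digraph_def complete_graph_def)

lemma pair_graph_disjoint_union: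
  assumes "finite I" "\<And>i. i \<in> I \<Longrightarrow> pair_graph (G i)"
  shows "pair_graph (disjoint_union I G)"
proof -
  have "{(i, v). i \<in> I \<and> v \<in> pverts (G i)} = Sigma I (\<lambda>i. pverts (G i))"
    by auto
  then have "finite {(i, v). i \<in> I \<and> v \<in> pverts (G i)}"
    using assms by (simp add: pair_graph_iff)
  with assms(2) show ?thesis
    unfolding pair_graph_iff disjoint_union_def by (fastforce simp: sym_def)
qed

lemma pair_graph_copies: "pair_graph G \<Longrightarrow> pair_graph (copies m G)"
  by (simp add: copies_def pair_graph_disjoint_union)

lemma pair_graph_family_join:
  assumes "finite I" "\<And>i. i \<in> I \<Longrightarrow> pair_graph (G i)"
  shows "pair_graph (family_join I G)"
  using pair_graph_disjoint_union[of I G, OF assms]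
  unfolding pair_graph_iff family_join_def
  by (auto simp: sym_def disjoint_union_def)

lemma pair_graph_join:
  assumes "pair_graph G" "pair_graph H"
  shows "pair_graph (graph_join G H)"
  using assms unfolding pair_graph_iff graph_join_def by (auto simp: sym_def)

lemma pair_graph_X_graph: "pair_graph (X_graph h r)"
  unfolding X_graph_def
  by (intro pair_graph_join pair_graph_edgeless pair_graph_family_join pair_graph_copies
      pair_graph_complete) simp

lemma pair_graph_r_direction:
  assumes "pair_graph G" "new_vertices G m x y"
  shows "pair_graph (r_direction G m x y)"
proof -
  have "x j \<noteq> y j" if "j \<in> {1..m}" for j
    using assms(2) that unfolding new_vertices_def by blast
  with assms show ?thesis
    unfolding pair_graph_iff r_direction_def new_vertices_def Let_def
    by (auto simp: sym_def)
qed

end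

theory Submission
  imports Defs
begin

text \<open>
  \<^term>\<open>X_graph h (r + 1)\<close> is literally the \<open>r\<close>-direction construction applied to
  \<^term>\<open>X_graph h r\<close>, the new vertices being those of the last constituent of the join; and the
  construction respects isomorphism, since an isomorphism of the base graphs extends to the new
  vertices by \<open>x j \<mapsto> x' j\<close>, \<open>y j \<mapsto> y' j\<close>.
\<close>

text \<open>Under \<open>with_proj\<close> tail and head are \<open>fst\<close> and
  \<open>snd\<close>, so the vertex map forces the arc map to be \<open>map_prod f f\<close>.
  Well-formedness of \<open>G\<close> appears because \<open>digraph_isomorphism\<close> includes
  it.\<close>

lemma digraph_iso_with_proj_iff:
  "digraph_iso (with_proj G) (with_proj H) \<longleftrightarrow>
     pair_wf_digraph G \<and>
     (\<exists>f. bij_betw f (pverts G) (pverts H) \<and> map_prod f f ` parcs G = parcs H)" (is "?L \<longleftrightarrow> ?R")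
proof
  assume ?L
  then obtain f where f: "pre_digraph.digraph_isomorphism (with_proj G) f"
    and H: "with_proj H = app_iso f (with_proj G)"
    by (auto simp: digraph_iso_def)
  have eqs: "pverts H = iso_verts f ` pverts G" "parcs H = iso_arcs f ` parcs G"
    "iso_tail f = fst" "iso_head f = snd"
    using H by (simp_all add: with_proj_def app_iso_def)
  have "iso_arcs f a = map_prod (iso_verts f) (iso_verts f) a" if "a \<in> parcs G" for a
    using f that
    by (cases a) (auto simp: pre_digraph.digraph_isomorphism_def eqs prod_eq_iff)
  then have "map_prod (iso_verts f) (iso_verts f) ` parcs G = parcs H"
    unfolding eqs by (intro image_cong) auto
  moreover have "bij_betw (iso_verts f) (pverts G) (pverts H)" "pair_wf_digraph G"
    using f by (auto simp: pre_digraph.digraph_isomorphism_def eqs bij_betw_def wf_digraph_wp_iff)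
  ultimately show ?R by blast
next
  assume ?R
  then obtain f where wf: "pair_wf_digraph G" and f: "bij_betw f (pverts G) (pverts H)"
    and arcs: "map_prod f f ` parcs G = parcs H"
    by blast
  have sub: "parcs G \<subseteq> pverts G \<times> pverts G"
    using wf by (auto simp: pair_wf_digraph_def)
  have "inj_on (map_prod f f) (pverts G \<times> pverts G)"
    using f by (intro map_prod_inj_on) (auto simp: bij_betw_def)
  then have "inj_on (map_prod f f) (parcs G)"
    using sub by (rule inj_on_subset)
  with wf f arcs show ?L
    unfolding digraph_iso_def
    \<comment> \<open>Taking \<open>fst\<close> and \<open>snd\<close> as the new tail and head
      makes \<open>app_iso\<close> land in the form \<open>with_proj H\<close>.\<close>
    by (intro exI[of _ "\<lparr>iso_verts = f, iso_arcs = map_prod f f, iso_head = snd, iso_tail = fst\<rparr>"])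
      (auto simp: pre_digraph.digraph_isomorphism_def wf_digraph_wp_iff with_proj_def[of H] app_iso_def
        bij_betw_def)
qed

lemma pair_wf_digraph_r_direction:
  "pair_wf_digraph G \<Longrightarrow> pair_wf_digraph (r_direction G m x y)"
  by (auto simp: pair_wf_digraph_def r_direction_def Let_def)

lemma digraph_iso_r_direction:
  assumes iso: "digraph_iso (with_proj G) (with_proj H)"
    and new: "new_vertices G m x y" and new': "new_vertices H m x' y'"
  shows "digraph_iso (with_proj (r_direction G m x y)) (with_proj (r_direction H m x' y'))"
proof -
  obtain f where wf: "pair_wf_digraph G" and f: "bij_betw f (pverts G) (pverts H)"
    and arcs: "map_prod f f ` parcs G = parcs H"
    using iso by (auto simp: digraph_iso_with_proj_iff)
  define I where "I = {1..m}"
  \<comment> \<open>The inverses recover the index \<open>j\<close> of a new vertex; the case tests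
    cannot clash, since \<open>new\<close> keeps the ranges of \<open>x\<close>, \<open>y\<close>
    and the vertices of \<open>G\<close> apart.\<close>
  define g where "g v = (if v \<in> pverts G then f v
    else if v \<in> x ` I then x' (the_inv_into I x v) else y' (the_inv_into I y v))" for v
  have inj: "inj_on x I" "inj_on y I" "inj_on x' I" "inj_on y' I"
    and disj: "x ` I \<inter> y ` I = {}" "(x ` I \<union> y ` I) \<inter> pverts G = {}"
    and disj': "x' ` I \<inter> y' ` I = {}" "(x' ` I \<union> y' ` I) \<inter> pverts H = {}"
    using new new' by (auto simp: new_vertices_def I_def)
  have gG: "g v = f v" if "v \<in> pverts G" for v
    using that by (simp add: g_def)
  have gx: "g (x j) = x' j" if "j \<in> I" for j
    using that inj disj by (auto simp: g_def the_inv_into_f_f)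
  have gy: "g (y j) = y' j" if "j \<in> I" for j
  proof -
    have "y j \<notin> x ` I" "y j \<notin> pverts G" using that disj by auto
    then show ?thesis using that inj by (auto simp: g_def the_inv_into_f_f)
  qed
  have bij_x: "bij_betw g (x ` I) (x' ` I)" and bij_y: "bij_betw g (y ` I) (y' ` I)"
    using inj by (auto simp: bij_betw_def inj_on_def gx gy image_image cong: image_cong)
  \<comment> \<open>Glued bijections stay injective because their targets are disjoint, which
    \<open>new'\<close> supplies.\<close>
  have bij_V: "bij_betw g (x ` I \<union> y ` I) (x' ` I \<union> y' ` I)"
    using bij_x bij_y disj'(1) by (rule bij_betw_combine)
  have bij_G: "bij_betw g (pverts G) (pverts H)"
    using f gG by (simp cong: bij_betw_cong)
  have bij: "bij_betw g (pverts G \<union> (x ` I \<union> y ` I)) (pverts H \<union> (x' ` I \<union> y' ` I))"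
    using bij_G bij_V by (rule bij_betw_combine) (use disj' in auto)
  have img: "g ` pverts G = pverts H" "g ` (x ` I \<union> y ` I) = x' ` I \<union> y' ` I"
    using bij_G bij_V by (simp_all add: bij_betw_def)
  have "parcs G \<subseteq> pverts G \<times> pverts G"
    using wf by (auto simp: pair_wf_digraph_def)
  then have "map_prod g g ` parcs G = map_prod f f ` parcs G"
    by (intro image_cong) (auto simp: gG)
  moreover have "map_prod g g ` (\<Union>j\<in>I. {(x j, y j), (y j, x j)}) =
      (\<Union>j\<in>I. {(x' j, y' j), (y' j, x' j)})"
    by (simp add: image_UN gx gy)
  \<comment> \<open>The join arcs form full products, so the images of the factors determine their
    image.\<close>
  moreover have "map_prod g g ` (A \<times> B) = (g ` A) \<times> (g ` B)" for A B
    by (rule map_prod_surj_on) auto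
  ultimately have "map_prod g g ` parcs (r_direction G m x y) = parcs (r_direction H m x' y')"
    using arcs img by (simp add: r_direction_def Let_def image_Un[of "map_prod g g"]
        flip: I_def del: One_nat_def)
  with bij wf show ?thesis
    unfolding digraph_iso_with_proj_iff
    by (intro conjI exI[of _ g] pair_wf_digraph_r_direction)
      (auto simp: r_direction_def Let_def I_def)
qed

text \<open>The tag \<open>r + 1\<close> lies outside \<open>{1..r}\<close>, and the last component
  separates the two ends of each new edge.\<close>

lemma new_vertices_X_graph:
  "new_vertices (X_graph h r) m (\<lambda>j. Inr (r + 1, j, 0)) (\<lambda>j. Inr (r + 1, j, 1))"
  by (auto simp: new_vertices_def inj_on_def X_graph_def graph_join_def family_join_def
      disjoint_union_def)

text \<open>Equality holds on the nose because earlier constituents keep their tags. The last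
  constituent is joined to them by \<open>family_join\<close> and to the edgeless part by
  \<open>graph_join\<close>.\<close>

lemma X_graph_Suc:
  "X_graph h (r + 1) =
     r_direction (X_graph h r) (h div 2) (\<lambda>j. Inr (r + 1, j, 0)) (\<lambda>j. Inr (r + 1, j, 1))"
  (is "?X = ?Y")
proof -
  have verts: "pverts ?X = pverts ?Y"
    unfolding X_graph_def graph_join_def family_join_def copies_def disjoint_union_def
      r_direction_def complete_graph_def Let_def
    \<comment> \<open>\<open>le_Suc_eq\<close> splits off the constituent \<open>r + 1\<close>;
      \<open>less_2_cases_iff\<close> splits each \<open>K_2\<close> into its ends 0 and 1.\<close>
    by (auto simp: le_Suc_eq less_2_cases_iff)
  have "a \<in> parcs ?X \<longleftrightarrow> a \<in> parcs ?Y" for a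
  proof -
    obtain u v where "a = (u, v)" by (cases a)
    then show ?thesis
      unfolding X_graph_def graph_join_def family_join_def copies_def disjoint_union_def
        r_direction_def complete_graph_def edgeless_graph_def Let_def
      by (cases u; cases v) (auto simp: le_Suc_eq less_2_cases_iff image_iff)
  qed
  with verts show ?thesis
    by (intro pair_pre_digraph.equality) auto
qed

text \<open>Letting \<open>X\<close> be any isomorphic copy of \<open>X_graph h r\<close> leaves the
  labels of old and new vertices arbitrary.\<close>

theorem theorem6p2:
  fixes h r :: nat
    and X :: "'a pair_pre_digraph"
    and x y :: "nat \<Rightarrow> 'a"
  assumes "even h" and "h \<ge> 2" and "r \<ge> 1"
    and "digraph_iso (with_proj X) (with_proj (X_graph h r))"
    and "new_vertices X (h div 2) x y"
  shows "digraph_iso (with_proj (r_direction X (h div 2) x y)) (with_proj (X_graph h (r + 1)))"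
  unfolding X_graph_Suc using assms(4,5) new_vertices_X_graph by (rule digraph_iso_r_direction)

end
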